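(* One has $\mathrm{int}(\overline{\mathbb H}_\mu)=\mathbb H$ and $$\overline{\mathbb H}_\mu=\overline{\mathbb H}=\left\{(a,x_1,x_2,x_3)\in\mathbb C\times\overline{\mathbb E}:\ \left|\frac{a\sqrt{(1-|z_1|^2)(1-|z_2|^2)}}{1-x_1z_1-x_2z_2+x_3z_1z_2}\right|\le1\ \text{for every } z_1,z_2\in\mathbb D\right\}.$$ Moreover, $\overline{\mathbb H}_N\subseteq\overline{\mathbb H}\subseteq\overline{\mathbb D}\times\overline{\mathbb D}\times\overline{\mathbb D}\times\overline{\mathbb D}$.
   Context: $\mathbb D$ is the open unit disc in $\mathbb C$, $\overline{\mathbb D}$ its closure; $\mathrm{int}(\cdot)$ and overlines denote interior and closure (in $\mathbb C^4$, or in $\mathbb C^3$ for $\mathbb E$); $\|\cdot\|$ is the operator norm on $M_2(\mathbb C)$ induced by the Euclidean norm on $\mathbb C^2$. Let $E\subset M_2(\mathbb C)$ be the linear space of all upper triangular matrices. For $A\in M_2(\mathbb C)$, $$\mu_{\mathrm{hexa}}(A)=\frac{1}{\inf\{\|X\| : X\in E,\ \det(I-AX)=0\}},$$ with $\mu_{\mathrm{hexa}}(A)=0$ if $\det(I-AX)\ne0$ for all $X\in E$. $\pi:M_2(\mathbb C)\to\mathbb C^4$ is $\pi((a_{ij}))=(a_{21},a_{11},a_{22},\det(A))$; $\mathbb H_\mu=\{\pi(A): A\in M_2(\mathbb C),\ \mu_{\mathrm{hexa}}(A)<1\}$; $\mathbb H_N=\{\pi(A): A\in M_2(\mathbb C),\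 \|A\|<1\}$. The tetrablock is $\mathbb E=\{(x_1,x_2,x_3)\in\mathbb C^3: 1-x_1z_1-x_2z_2+x_3z_1z_2\ne0 \text{ for all } z_1,z_2\in\overline{\mathbb D}\}$; its closure is $\overline{\mathbb E}=\{(x_1,x_2,x_3)\in\mathbb C^3: 1-x_1z_1-x_2z_2+x_3z_1z_2\ne0 \text{ for all } z_1,z_2\in\mathbb D\}$ (known fact). The hexablock is $$\mathbb H=\left\{(a,x_1,x_2,x_3)\in\mathbb C\times\mathbb E:\ \sup_{z_1,z_2\in\mathbb D}\left|\frac{a\sqrt{(1-|z_1|^2)(1-|z_2|^2)}}{1-x_1z_1-x_2z_2+x_3z_1z_2}\right|<1\right\}.$$ *)

theory Defs
  imports "HOL-Analysis.Analysis" "HOL-Library.Extended_Real"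
begin

text \<open>
  $M_2(\mathbb C)$ is the type \<open>complex^2^2\<close>, with \<open>A $ i $ j\<close> the entry in row \<open>i\<close> and column \<open>j\<close>;
  $\mathbb C^3$ and $\mathbb C^4$ are nested products of \<open>complex\<close>, whose topology is the usual one.
  The norm of \<open>complex^2\<close> is the Euclidean one, so \<open>onorm ((*v) A)\<close> is the induced operator norm;
  the open and closed unit discs are \<open>ball 0 1\<close> and \<open>cball 0 1\<close>.
\<close>

abbreviation op_norm :: "complex^2^2 \<Rightarrow> real"
  where "op_norm A \<equiv> onorm (\<lambda>v. A *v v)"

definition upper_triangular_mats :: "(complex^2^2) set"
  where "upper_triangular_mats = {X. X $ 2 $ 1 = 0}"

definition mu_hexa :: "complex^2^2 \<Rightarrow> real"
  where "mu_hexa A =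
    (if \<forall>X\<in>upper_triangular_mats. det (mat 1 - A ** X) \<noteq> 0 then 0
     else 1 / Inf {op_norm X | X. X \<in> upper_triangular_mats \<and> det (mat 1 - A ** X) = 0})"

definition hexa_proj :: "complex^2^2 \<Rightarrow> complex \<times> complex \<times> complex \<times> complex"
  where "hexa_proj A = (A $ 2 $ 1, A $ 1 $ 1, A $ 2 $ 2, det A)"

definition H_mu :: "(complex \<times> complex \<times> complex \<times> complex) set"
  where "H_mu = {hexa_proj A | A. mu_hexa A < 1}"

definition H_N :: "(complex \<times> complex \<times> complex \<times> complex) set"
  where "H_N = {hexa_proj A | A. op_norm A < 1}"

definition tetrablock :: "(complex \<times> complex \<times> complex) set"
  where "tetrablock = {(x1, x2, x3).
    \<forall>z1\<in>cball 0 1. \<forall>z2\<in>cball 0 1. 1 - x1 * z1 - x2 * z2 + x3 * z1 * z2 \<noteq> 0}"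

definition hexa_quot ::
    "complex \<Rightarrow> complex \<Rightarrow> complex \<Rightarrow> complex \<Rightarrow> complex \<Rightarrow> complex \<Rightarrow> complex"
  where "hexa_quot a x1 x2 x3 z1 z2 =
    a * complex_of_real (sqrt ((1 - (cmod z1)\<^sup>2) * (1 - (cmod z2)\<^sup>2)))
      / (1 - x1 * z1 - x2 * z2 + x3 * z1 * z2)"

text \<open>
  The supremum is taken in the extended reals, so that it is meaningful without a separate
  boundedness condition.
\<close>

definition hexablock :: "(complex \<times> complex \<times> complex \<times> complex) set"
  where "hexablock = {(a, x1, x2, x3). (x1, x2, x3) \<in> tetrablock \<and>
    (SUP (z1, z2)\<in>ball 0 1 \<times> ball 0 1. ereal (cmod (hexa_quot a x1 x2 x3 z1 z2))) < 1}"

end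

theory Submission
  imports Defs
begin

text \<open>
  Write $p(z_1,z_2) = 1 - x_1 z_1 - x_2 z_2 + x_3 z_1 z_2$ and
  $\delta(z_1,z_2) = \sqrt{(1-|z_1|^2)(1-|z_2|^2)}$.

  For a matrix $A$ with $\pi(A) = (a,x_1,x_2,x_3)$ and an upper triangular $X$ with diagonal
  $z_1,z_2$ and corner $w$ one has $\det(I-AX) = p(z_1,z_2) - aw$, and $\|X\|\le 1$ means that
  $z_1,z_2$ lie in the closed disc and $|w|\le\delta(z_1,z_2)$. So $\det(I-AX)$ has no zero on the
  unit ball of the upper triangular matrices exactly when $|a|\,\delta < |p|$ on the closed bidisc.
  The latter strict inequality characterises the hexablock
  (\<open>mem_hexablock_iff\<close>): the supremum in its definition is attained on the closed bidisc by
  compactness, and $\delta$ vanishes on the topological boundary. Being an open condition that is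
  imposed over a compact set, it also shows that the hexablock is open.

  Everything topological then follows from the dilations
  $(a,x_1,x_2,x_3) \mapsto (ra, rx_1, rx_2, r^2x_3)$, which replace $p(z_1,z_2)$ by $p(rz_1,rz_2)$.
  Let $T$ be the set given by $p\ne0$ and $|a|\,\delta\le|p|$ on the open bidisc. A dilation with
  $r<1$ maps $T$ into the hexablock, because $r\,\delta(z_1,z_2) < \delta(rz_1,rz_2)$
  (\<open>dilate_mem_hexablock\<close>).
  Letting $r\to1$ from below gives that $T$ lies in the closure of the hexablock. Near an interior
  point of $T$ there is still a point of $T$ obtained by a dilation with $s>1$, and the dilation by
  $1/s$ brings it back, so the interior of $T$ is contained in the hexablock.
  Conversely the inequality $|a|\,\delta\le|p|$ is closed, and $p$ has no zero in the open bidisc for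
  points in the closure of the tetrablock since $|x_2-x_3z|\le|1-x_1z|$ there.

  Finally, $\mu_{\mathrm{hexa}}(A)<1$ forces $\pi(A)$ into the hexablock, and conversely if $\pi(A)$ is
  in the hexablock then $\mu_{\mathrm{hexa}}(rA)<1$ for $r<1$. The points with $a\ne0$ are all
  of the form $\pi(A)$, and they are dense in the open hexablock, hence both sets have the same
  closure.
\<close>

section \<open>The pencil of the tetrablock and contractive triangular matrices\<close>

definition tetra_poly :: "complex \<Rightarrow> complex \<Rightarrow> complex \<Rightarrow> complex \<Rightarrow> complex \<Rightarrow> complex"
  where "tetra_poly x1 x2 x3 z1 z2 = 1 - x1 * z1 - x2 * z2 + x3 * z1 * z2"

text \<open>
  By \<open>op_norm_triangular_le_1_iff\<close> below, this is the largest modulus of a corner entry that turns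
  the diagonal \<open>z1\<close>, \<open>z2\<close> into a contractive triangular matrix.
\<close>

definition defect :: "complex \<Rightarrow> complex \<Rightarrow> real"
  where "defect z1 z2 = sqrt ((1 - (cmod z1)\<^sup>2) * (1 - (cmod z2)\<^sup>2))"

lemma one_minus_cmod_sq_nonneg: "0 \<le> 1 - (cmod z)\<^sup>2" if "z \<in> cball 0 1"
  using that by (simp add: abs_square_le_1)

lemma one_minus_cmod_sq_pos: "0 < 1 - (cmod z)\<^sup>2" if "z \<in> ball 0 1"
  using that by (simp add: abs_square_less_1)

lemma defect_nonneg: "0 \<le> defect z1 z2" if "z1 \<in> cball 0 1" "z2 \<in> cball 0 1"
  unfolding defect_def using one_minus_cmod_sq_nonneg[OF that(1)] one_minus_cmod_sq_nonneg[OF that(2)]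
  by simp

lemma cmod_hexa_quot:
  "cmod (hexa_quot a x1 x2 x3 z1 z2) = cmod a * defect z1 z2 / cmod (tetra_poly x1 x2 x3 z1 z2)"
  if "z1 \<in> cball 0 1" "z2 \<in> cball 0 1"
  using defect_nonneg[OF that]
  by (simp add: hexa_quot_def defect_def tetra_poly_def norm_divide norm_mult)

text \<open>
  The corner entry \<open>A $ 1 $ 2\<close> occurs on the right only through \<open>det A\<close>; this is why the four
  coordinates of \<open>hexa_proj A\<close> determine the determinant of the pencil.
\<close>

lemma det_pencil:
  assumes "X \<in> upper_triangular_mats"
  shows "det (mat 1 - A ** X)
    = tetra_poly (A $ 1 $ 1) (A $ 2 $ 2) (det A) (X $ 1 $ 1) (X $ 2 $ 2) - A $ 2 $ 1 * X $ 1 $ 2"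
  using assms
  by (simp add: upper_triangular_mats_def det_2 mat_def matrix_matrix_mult_def sum_2
      tetra_poly_def algebra_simps)

lemma norm_sq_vec2: "(norm (v :: complex^2))\<^sup>2 = (cmod (v $ 1))\<^sup>2 + (cmod (v $ 2))\<^sup>2"
  by (simp add: norm_vec_def L2_set_def sum_2)

lemma op_norm_le_1_iff_contraction: "op_norm A \<le> 1 \<longleftrightarrow> (\<forall>v. norm (A *v v) \<le> norm v)"
proof
  assume "op_norm A \<le> 1"
  then show "\<forall>v. norm (A *v v) \<le> norm v"
    using onorm[OF matrix_vector_mul_bounded_linear[of A]]
    by (meson mult_left_le_one_le norm_ge_zero onorm_pos_le matrix_vector_mul_bounded_linear order_trans)
next
  assume "\<forall>v. norm (A *v v) \<le> norm v"
  then show "op_norm A \<le> 1"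
    by (intro onorm_le) simp
qed

lemma op_norm_triangular_le_1_iff_quadratic:
  assumes "X \<in> upper_triangular_mats"
  shows "op_norm X \<le> 1 \<longleftrightarrow> (\<forall>u v. (cmod (X $ 1 $ 1 * u + X $ 1 $ 2 * v))\<^sup>2 + (cmod (X $ 2 $ 2 * v))\<^sup>2
     \<le> (cmod u)\<^sup>2 + (cmod v)\<^sup>2)" (is "_ \<longleftrightarrow> (\<forall>u v. ?Q u v)")
proof -
  have *: "norm (X *v y) \<le> norm y \<longleftrightarrow> ?Q (y $ 1) (y $ 2)" for y
  proof -
    have "norm (X *v y) \<le> norm y \<longleftrightarrow> (norm (X *v y))\<^sup>2 \<le> (norm y)\<^sup>2"
      by (simp add: power_mono_iff)
    also have "\<dots> \<longleftrightarrow> ?Q (y $ 1) (y $ 2)"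
      using assms unfolding norm_sq_vec2
      by (simp add: upper_triangular_mats_def matrix_vector_mult_def sum_2)
    finally show ?thesis .
  qed
  show ?thesis
    unfolding op_norm_le_1_iff_contraction
  proof (intro iffI allI)
    fix u v
    assume "\<forall>v. norm (X *v v) \<le> norm v"
    then show "?Q u v"
      using *[of "vector [u, v]"] by simp
  qed (use * in blast)
qed

text \<open>
  Contractivity says that $I - X^*X$ is positive semidefinite. The condition on the corner
  is the nonnegativity of $\det(I-X^*X) = \delta(z_1,z_2)^2-|w|^2$. It is extracted by testing the quadratic
  form on a vector that realises the Schur complement; the other direction is the Cauchy-Schwarz
  inequality for $(|z_1|, \sqrt{1-|z_1|^2})$, which is a unit vector.
\<close>

lemma op_norm_triangular_le_1_iff:
  assumes "X \<in> upper_triangular_mats"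
  shows "op_norm X \<le> 1 \<longleftrightarrow> X $ 1 $ 1 \<in> cball 0 1 \<and> X $ 2 $ 2 \<in> cball 0 1 \<and>
    cmod (X $ 1 $ 2) \<le> defect (X $ 1 $ 1) (X $ 2 $ 2)"
proof -
  define z1 z2 w where "z1 = X $ 1 $ 1" and "z2 = X $ 2 $ 2" and "w = X $ 1 $ 2"
  define S where "S = 1 - (cmod z1)\<^sup>2"
  note quad = op_norm_triangular_le_1_iff_quadratic[OF assms, folded z1_def z2_def w_def]
  show ?thesis
    unfolding z1_def[symmetric] z2_def[symmetric] w_def[symmetric] quad
  proof (intro iffI conjI allI)
    assume Q: "\<forall>u v. (cmod (z1 * u + w * v))\<^sup>2 + (cmod (z2 * v))\<^sup>2 \<le> (cmod u)\<^sup>2 + (cmod v)\<^sup>2"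
    from Q[rule_format, of 1 0] have "(cmod z1)\<^sup>2 \<le> 1" by simp
    then show z1: "z1 \<in> cball 0 1" by (simp add: abs_square_le_1)
    have S0: "0 \<le> S" unfolding S_def by (rule one_minus_cmod_sq_nonneg[OF z1])
    from Q[rule_format, of 0 1] have wz2: "(cmod w)\<^sup>2 + (cmod z2)\<^sup>2 \<le> 1" by simp
    then have "(cmod z2)\<^sup>2 \<le> 1" using zero_le_power2[of "cmod w"] by linarith
    then show z2: "z2 \<in> cball 0 1" by (simp add: abs_square_le_1)
    have "(cmod w)\<^sup>2 \<le> S * (1 - (cmod z2)\<^sup>2)"
    proof (cases "S = 0")
      case False
      \<comment> \<open>Test vector \<open>(cnj z1 * w, S)\<close>: its image has first entry \<open>w\<close>.\<close>
      have "z1 * (cnj z1 * w) + w * of_real S = w * of_real ((cmod z1)\<^sup>2 + S)"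
        by (simp add: complex_norm_square algebra_simps del: of_real_power)
      also have "\<dots> = w" by (simp add: S_def)
      finally have "(cmod w)\<^sup>2 + (cmod z2 * S)\<^sup>2 \<le> (cmod z1 * cmod w)\<^sup>2 + S\<^sup>2"
        using Q[rule_format, of "cnj z1 * w" "of_real S"] S0 by (simp add: norm_mult)
      then have "S * (cmod w)\<^sup>2 \<le> S * (S * (1 - (cmod z2)\<^sup>2))"
        by (simp add: S_def power_mult_distrib algebra_simps power2_eq_square)
      then show ?thesis using False S0 by simp
    next
      case True
      \<comment> \<open>The previous test vector is uninformative when \<open>|z1| = 1\<close>; the conjugated first row
        \<open>(cnj z1, cnj w)\<close> shows that a row of norm at most 1 leaves no room for \<open>w\<close>.\<close>
      define W where "W = (cmod w)\<^sup>2"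
      have "z1 * cnj z1 + w * cnj w = of_real ((cmod z1)\<^sup>2 + (cmod w)\<^sup>2)"
        by (simp add: complex_norm_square del: of_real_power)
      then have "cmod (z1 * cnj z1 + w * cnj w) = \<bar>(cmod z1)\<^sup>2 + (cmod w)\<^sup>2\<bar>"
        by (simp only: norm_of_real)
      also have "\<dots> = 1 + W"
        using True by (simp add: S_def W_def)
      finally have "(1 + W)\<^sup>2 + (cmod z2 * cmod w)\<^sup>2 \<le> 1 + W"
        using Q[rule_format, of "cnj z1" "cnj w"] True by (simp add: norm_mult W_def S_def)
      moreover have "0 \<le> W" by (simp add: W_def)
      ultimately have "W = 0"
        using zero_le_power2[of "cmod z2 * cmod w"] zero_le_power2[of W]
        unfolding power2_sum power_one by linarith
      then show ?thesis using True by (simp add: W_def)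
    qed
    then show "cmod w \<le> defect z1 z2"
      unfolding defect_def S_def by (rule real_le_rsqrt)
  next
    fix u v
    assume K: "z1 \<in> cball 0 1 \<and> z2 \<in> cball 0 1 \<and> cmod w \<le> defect z1 z2"
    have cauchy_schwarz: "(p * q + s * t)\<^sup>2 \<le> (p\<^sup>2 + s\<^sup>2) * (q\<^sup>2 + t\<^sup>2)" for p q s t :: real
      using zero_le_power2[of "p * t - s * q"] by (simp add: power2_eq_square algebra_simps)
    define R where "R = 1 - (cmod z2)\<^sup>2"
    have nn: "0 \<le> S" "0 \<le> R"
      using K one_minus_cmod_sq_nonneg unfolding S_def R_def by blast+
    have sq: "(sqrt S)\<^sup>2 = S" "(sqrt R)\<^sup>2 = R" using nn by simp_all
    have w: "cmod w \<le> sqrt S * sqrt R"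
      using K by (simp add: defect_def S_def R_def real_sqrt_mult)
    have "cmod (z1 * u + w * v) \<le> cmod z1 * cmod u + cmod w * cmod v"
      by (metis norm_mult norm_triangle_ineq)
    also have "\<dots> \<le> cmod z1 * cmod u + sqrt S * (sqrt R * cmod v)"
      using mult_right_mono[OF w, of "cmod v"] by (simp add: mult.assoc)
    finally have "(cmod (z1 * u + w * v))\<^sup>2 \<le> (cmod z1 * cmod u + sqrt S * (sqrt R * cmod v))\<^sup>2"
      by (rule power_mono) simp
    also have "\<dots> \<le> ((cmod z1)\<^sup>2 + (sqrt S)\<^sup>2) * ((cmod u)\<^sup>2 + (sqrt R * cmod v)\<^sup>2)"
      by (rule cauchy_schwarz)
    also have "\<dots> = (cmod u)\<^sup>2 + R * (cmod v)\<^sup>2"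
      unfolding power_mult_distrib sq by (simp add: S_def)
    finally show "(cmod (z1 * u + w * v))\<^sup>2 + (cmod (z2 * v))\<^sup>2 \<le> (cmod u)\<^sup>2 + (cmod v)\<^sup>2"
      by (simp add: R_def norm_mult power_mult_distrib algebra_simps)
  qed
qed

section \<open>Membership in the hexablock\<close>

lemma tetra_poly_continuous [continuous_intros]:
  assumes "continuous_on S f1" "continuous_on S f2" "continuous_on S f3"
    "continuous_on S g1" "continuous_on S g2"
  shows "continuous_on S (\<lambda>t. tetra_poly (f1 t) (f2 t) (f3 t) (g1 t) (g2 t))"
  unfolding tetra_poly_def by (intro continuous_intros assms)

lemma defect_continuous [continuous_intros]:
  assumes "continuous_on S g1" "continuous_on S g2"
  shows "continuous_on S (\<lambda>t. defect (g1 t) (g2 t))"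
  unfolding defect_def by (intro continuous_intros assms)

text \<open>
  The right-hand side subsumes nonvanishing of the polynomial, as its left member is nonnegative.
  On the topological boundary of the bidisc it amounts to that nonvanishing, because there \<open>defect\<close>
  is zero. This makes it possible to pass from the open bidisc to the compact closed one, where the supremum of
  the quotient is attained.
\<close>

lemma mem_hexablock_iff:
  "(a, x1, x2, x3) \<in> hexablock \<longleftrightarrow>
    (\<forall>z1\<in>cball 0 1. \<forall>z2\<in>cball 0 1. cmod a * defect z1 z2 < cmod (tetra_poly x1 x2 x3 z1 z2))"
  (is "?L \<longleftrightarrow> ?R")
proof
  assume ?L
  then have tet: "(x1, x2, x3) \<in> tetrablock"
    and sup: "(SUP (z1, z2)\<in>ball 0 1 \<times> ball 0 1. ereal (cmod (hexa_quot a x1 x2 x3 z1 z2))) < 1"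
    by (simp_all add: hexablock_def)
  show ?R
  proof (intro ballI)
    fix z1 z2 :: complex
    assume z: "z1 \<in> cball 0 1" "z2 \<in> cball 0 1"
    have p: "tetra_poly x1 x2 x3 z1 z2 \<noteq> 0"
      using tet z by (simp add: tetrablock_def tetra_poly_def)
    show "cmod a * defect z1 z2 < cmod (tetra_poly x1 x2 x3 z1 z2)"
    proof (cases "z1 \<in> ball 0 1 \<and> z2 \<in> ball 0 1")
      case True
      then have "ereal (cmod (hexa_quot a x1 x2 x3 z1 z2)) < 1"
        using SUP_lessD[OF sup, of "(z1, z2)"] by simp
      then show ?thesis
        using p cmod_hexa_quot[OF z, of a x1 x2 x3] by (simp add: divide_less_eq)
    next
      case False
      then have "cmod z1 = 1 \<or> cmod z2 = 1" using z by auto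
      then have "defect z1 z2 = 0" by (auto simp: defect_def)
      then show ?thesis using p by simp
    qed
  qed
next
  assume R: ?R
  have p: "tetra_poly x1 x2 x3 z1 z2 \<noteq> 0" if "z1 \<in> cball 0 1" "z2 \<in> cball 0 1" for z1 z2
    using R[rule_format, OF that] defect_nonneg[OF that]
    by (metis mult_nonneg_nonneg norm_ge_zero norm_zero not_le)
  have cont: "continuous_on (cball 0 1 \<times> cball 0 1)
    (\<lambda>z. cmod a * defect (fst z) (snd z) / cmod (tetra_poly x1 x2 x3 (fst z) (snd z)))"
    using p by (intro continuous_intros) auto
  have "compact (cball 0 1 \<times> cball 0 1 :: (complex \<times> complex) set)"
    by (intro compact_Times compact_cball)
  from continuous_attains_sup[OF this _ cont] obtain y1 y2 :: complex
    where y: "y1 \<in> cball 0 1" "y2 \<in> cball 0 1"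
      and max: "\<And>z1 z2. z1 \<in> cball 0 1 \<Longrightarrow> z2 \<in> cball 0 1 \<Longrightarrow>
        cmod a * defect z1 z2 / cmod (tetra_poly x1 x2 x3 z1 z2)
        \<le> cmod a * defect y1 y2 / cmod (tetra_poly x1 x2 x3 y1 y2)"
    by fastforce
  have "(SUP (z1, z2)\<in>ball 0 1 \<times> ball 0 1. ereal (cmod (hexa_quot a x1 x2 x3 z1 z2)))
    \<le> ereal (cmod a * defect y1 y2 / cmod (tetra_poly x1 x2 x3 y1 y2))"
  proof (rule SUP_least, clarify)
    fix z1 z2 :: complex
    assume "z1 \<in> ball 0 1" "z2 \<in> ball 0 1"
    then have "z1 \<in> cball 0 1" "z2 \<in> cball 0 1" by auto
    then show "ereal (cmod (hexa_quot a x1 x2 x3 z1 z2))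
      \<le> ereal (cmod a * defect y1 y2 / cmod (tetra_poly x1 x2 x3 y1 y2))"
      using max by (simp add: cmod_hexa_quot)
  qed
  also have "\<dots> < 1"
    using R[rule_format, OF y] p[OF y] by (simp add: divide_less_eq)
  finally show ?L
    using p by (simp add: hexablock_def tetrablock_def tetra_poly_def)
qed

text \<open>
  For fixed diagonal, the products \<open>A $ 2 $ 1 * w\<close> with admissible corner \<open>w\<close> fill the closed disc of
  radius \<open>cmod (A $ 2 $ 1) * defect z1 z2\<close>, so the determinant of the pencil avoids zero iff
  \<open>tetra_poly\<close> is outside that disc.
\<close>

lemma hexa_proj_mem_hexablock_iff:
  "hexa_proj A \<in> hexablock \<longleftrightarrow>
    (\<forall>X\<in>upper_triangular_mats. op_norm X \<le> 1 \<longrightarrow> det (mat 1 - A ** X) \<noteq> 0)"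
  (is "?L \<longleftrightarrow> ?R")
proof
  assume L: ?L
  show ?R
  proof (intro ballI impI)
    fix X
    assume X: "X \<in> upper_triangular_mats" and "op_norm X \<le> 1"
    then have z: "X $ 1 $ 1 \<in> cball 0 1" "X $ 2 $ 2 \<in> cball 0 1"
      and w: "cmod (X $ 1 $ 2) \<le> defect (X $ 1 $ 1) (X $ 2 $ 2)"
      by (auto simp: op_norm_triangular_le_1_iff)
    have "cmod (A $ 2 $ 1 * X $ 1 $ 2) \<le> cmod (A $ 2 $ 1) * defect (X $ 1 $ 1) (X $ 2 $ 2)"
      using w by (simp add: norm_mult mult_left_mono)
    also have "\<dots> < cmod (tetra_poly (A $ 1 $ 1) (A $ 2 $ 2) (det A) (X $ 1 $ 1) (X $ 2 $ 2))"
      using L z unfolding hexa_proj_def mem_hexablock_iff by blast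
    finally show "det (mat 1 - A ** X) \<noteq> 0"
      by (auto simp: det_pencil[OF X])
  qed
next
  assume R: ?R
  show ?L
    unfolding hexa_proj_def mem_hexablock_iff
  proof (intro ballI, rule ccontr)
    fix z1 z2 :: complex
    assume z: "z1 \<in> cball 0 1" "z2 \<in> cball 0 1"
    define p where "p = tetra_poly (A $ 1 $ 1) (A $ 2 $ 2) (det A) z1 z2"
    define w where "w = p / A $ 2 $ 1"
    assume "\<not> cmod (A $ 2 $ 1) * defect z1 z2 < cmod (tetra_poly (A $ 1 $ 1) (A $ 2 $ 2) (det A) z1 z2)"
    then have ge: "cmod p \<le> cmod (A $ 2 $ 1) * defect z1 z2" by (simp add: p_def)
    have w: "cmod w \<le> defect z1 z2"
      using ge defect_nonneg[OF z] by (auto simp: w_def norm_divide divide_le_eq mult.commute)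
    \<comment> \<open>If \<open>A $ 2 $ 1 = 0\<close>, then \<open>w = 0\<close> by the convention for division, and \<open>ge\<close> gives \<open>p = 0\<close>.\<close>
    have aw: "A $ 2 $ 1 * w = p"
      using ge by (auto simp: w_def)
    define X :: "complex^2^2" where "X = vector [vector [z1, w], vector [0, z2]]"
    have X: "X \<in> upper_triangular_mats" by (simp add: X_def upper_triangular_mats_def)
    moreover have "op_norm X \<le> 1"
      unfolding op_norm_triangular_le_1_iff[OF X] using z w by (simp add: X_def)
    moreover have "det (mat 1 - A ** X) = 0"
      unfolding det_pencil[OF X] using aw by (simp add: X_def p_def)
    ultimately show False using R by blast
  qed
qed

section \<open>Dilations\<close>

text \<open>
  The weights are those of the coordinates of \<open>hexa_proj\<close> as homogeneous polynomials in the matrix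
  entries.
\<close>

definition dilate :: "real \<Rightarrow> complex \<times> complex \<times> complex \<times> complex \<Rightarrow> complex \<times> complex \<times> complex \<times> complex"
  where "dilate r = (\<lambda>(a, x1, x2, x3). (r *\<^sub>R a, r *\<^sub>R x1, r *\<^sub>R x2, r\<^sup>2 *\<^sub>R x3))"

text \<open>
  The concrete description of the closure, with the quotient cleared of its denominator;
  \<open>closure_hexablock\<close> identifies the two.
\<close>

definition closed_hexablock :: "(complex \<times> complex \<times> complex \<times> complex) set"
  where "closed_hexablock = {(a, x1, x2, x3). \<forall>z1\<in>ball 0 1. \<forall>z2\<in>ball 0 1.
    tetra_poly x1 x2 x3 z1 z2 \<noteq> 0 \<and> cmod a * defect z1 z2 \<le> cmod (tetra_poly x1 x2 x3 z1 z2)}"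

text \<open>
  This holds because $r(1-t^2) < 1-r^2t^2$ for $0\le t\le1$: the difference is
  $(1-r)(1+rt^2)$. Here $z_1,z_2$ may lie on the circle, which makes the dilated inequality strict on the
  whole closed bidisc.
\<close>

lemma defect_dilated:
  assumes z: "z1 \<in> cball 0 1" "z2 \<in> cball 0 1" and r: "0 \<le> r" "r < 1"
  shows "r * defect z1 z2 < defect (r *\<^sub>R z1) (r *\<^sub>R z2)"
proof -
  have r2: "r\<^sup>2 < 1" using r by (simp add: abs_square_less_1)
  have lt: "r * (1 - (cmod z)\<^sup>2) < 1 - (cmod (r *\<^sub>R z))\<^sup>2" if "z \<in> cball 0 1" for z
  proof -
    have le: "(cmod z)\<^sup>2 \<le> 1" using that by (simp add: abs_square_le_1)
    have "r * (cmod z)\<^sup>2 * (1 - r) \<le> r * 1 * (1 - r)"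
      using le r by (intro mult_right_mono mult_left_mono) auto
    moreover have "0 < (1 - r)\<^sup>2" using r by simp
    ultimately have "0 < 1 - r + r * (cmod z)\<^sup>2 * (1 - r)"
      using r by (simp add: add_pos_nonneg)
    then show ?thesis
      using r by (simp add: power_mult_distrib algebra_simps power2_eq_square)
  qed
  have "r\<^sup>2 * ((1 - (cmod z1)\<^sup>2) * (1 - (cmod z2)\<^sup>2)) = (r * (1 - (cmod z1)\<^sup>2)) * (r * (1 - (cmod z2)\<^sup>2))"
    by (simp add: power2_eq_square)
  also have "\<dots> < (1 - (cmod (r *\<^sub>R z1))\<^sup>2) * (1 - (cmod (r *\<^sub>R z2))\<^sup>2)"
    using lt z one_minus_cmod_sq_nonneg r by (intro mult_strict_mono') auto
  finally have "sqrt (r\<^sup>2 * ((1 - (cmod z1)\<^sup>2) * (1 - (cmod z2)\<^sup>2))) < defect (r *\<^sub>R z1) (r *\<^sub>R z2)"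
    unfolding defect_def by (rule real_sqrt_less_mono)
  then show ?thesis
    using r by (simp add: defect_def real_sqrt_mult)
qed

lemma dilate_mem_hexablock:
  assumes p: "p \<in> closed_hexablock" and r: "0 \<le> r" "r < 1"
  shows "dilate r p \<in> hexablock"
proof -
  obtain a x1 x2 x3 where pe: "p = (a, x1, x2, x3)" by (cases p) auto
  show ?thesis
    unfolding pe dilate_def prod.case mem_hexablock_iff
  proof (intro ballI)
    fix z1 z2 :: complex
    assume z: "z1 \<in> cball 0 1" "z2 \<in> cball 0 1"
    have poly: "tetra_poly (r *\<^sub>R x1) (r *\<^sub>R x2) (r\<^sup>2 *\<^sub>R x3) z1 z2
      = tetra_poly x1 x2 x3 (r *\<^sub>R z1) (r *\<^sub>R z2)"
      by (simp add: tetra_poly_def scaleR_conv_of_real power2_eq_square algebra_simps)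
    have rz: "r *\<^sub>R z \<in> ball 0 1" if "z \<in> cball 0 1" for z :: complex
      using that r mult_mono[of r r "cmod z" 1] by auto
    have ne: "tetra_poly x1 x2 x3 (r *\<^sub>R z1) (r *\<^sub>R z2) \<noteq> 0"
      and le: "cmod a * defect (r *\<^sub>R z1) (r *\<^sub>R z2) \<le> cmod (tetra_poly x1 x2 x3 (r *\<^sub>R z1) (r *\<^sub>R z2))"
      using p rz z unfolding pe closed_hexablock_def by auto
    have "cmod a * (r * defect z1 z2) < cmod (tetra_poly x1 x2 x3 (r *\<^sub>R z1) (r *\<^sub>R z2))"
    proof (cases "a = 0")
      case True
      then show ?thesis using ne by simp
    next
      case False
      then have "cmod a * (r * defect z1 z2) < cmod a * defect (r *\<^sub>R z1) (r *\<^sub>R z2)"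
        using defect_dilated[OF z r] by simp
      then show ?thesis using le by linarith
    qed
    then show "cmod (r *\<^sub>R a) * defect z1 z2 < cmod (tetra_poly (r *\<^sub>R x1) (r *\<^sub>R x2) (r\<^sup>2 *\<^sub>R x3) z1 z2)"
      using r unfolding poly by (simp add: mult_ac)
  qed
qed

lemma isCont_dilate: "isCont (\<lambda>r. dilate r p) r0"
  by (cases p) (auto simp: dilate_def intro!: continuous_intros)

lemma dilate_one [simp]: "dilate 1 p = p"
  by (cases p) (simp add: dilate_def)

lemma dilate_dilate: "dilate r (dilate s p) = dilate (r * s) p"
  by (cases p) (simp add: dilate_def power_mult_distrib)

lemma mem_closure_of_dilates:
  assumes "\<And>r. 0 < r \<Longrightarrow> r < 1 \<Longrightarrow> dilate r p \<in> S"
  shows "p \<in> closure S"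
proof (rule Lim_in_closed_set[of "closure S"])
  show "((\<lambda>r. dilate r p) \<longlongrightarrow> p) (at_left 1)"
    using isCont_dilate[of 1 p] by (simp add: isCont_def filterlim_at_split)
  show "\<forall>\<^sub>F r in at_left (1::real). dilate r p \<in> closure S"
    using eventually_at_left_real[of 0 "1::real"] assms closure_subset
    by (auto elim!: eventually_mono)
qed simp_all

text \<open>
  An interior point can be dilated outwards a little without leaving the set; dilating back
  inwards then lands in the hexablock.
\<close>

lemma interior_closed_hexablock_subset: "interior closed_hexablock \<subseteq> hexablock"
proof
  fix p
  assume p: "p \<in> interior closed_hexablock"
  have "((\<lambda>s. dilate s p) \<longlongrightarrow> p) (at_right 1)"
    using isCont_dilate[of 1 p] by (simp add: isCont_def filterlim_at_split)
  then have "\<forall>\<^sub>F s in at_right 1. dilate s p \<in> interior closed_hexablock"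
    using p open_interior topological_tendstoD by blast
  moreover have "\<forall>\<^sub>F s in at_right 1. s \<in> {1<..<2::real}"
    by (rule eventually_at_right_real) simp
  ultimately have "\<forall>\<^sub>F s in at_right 1. dilate s p \<in> interior closed_hexablock \<and> s \<in> {1<..<2}"
    by (rule eventually_conj)
  then obtain s where s: "dilate s p \<in> interior closed_hexablock" "1 < s"
    using eventually_happens'[OF trivial_limit_at_right_real] by force
  then have "dilate (1 / s) (dilate s p) \<in> hexablock"
    using interior_subset by (intro dilate_mem_hexablock) auto
  then show "p \<in> hexablock"
    using s by (simp add: dilate_dilate)
qed

lemma hexablock_subset_closed_hexablock: "hexablock \<subseteq> closed_hexablock"
proof clarify
  fix a x1 x2 x3
  assume H: "(a, x1, x2, x3) \<in> hexablock"
  have "tetra_poly x1 x2 x3 z1 z2 \<noteq> 0 \<and> cmod a * defect z1 z2 \<le> cmod (tetra_poly x1 x2 x3 z1 z2)"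
    if "z1 \<in> ball 0 1" "z2 \<in> ball 0 1" for z1 z2
  proof -
    have z: "z1 \<in> cball 0 1" "z2 \<in> cball 0 1" using that by auto
    have "cmod a * defect z1 z2 < cmod (tetra_poly x1 x2 x3 z1 z2)"
      using H z by (simp add: mem_hexablock_iff)
    moreover have "0 \<le> cmod a * defect z1 z2" using defect_nonneg[OF z] by simp
    ultimately show ?thesis by auto
  qed
  then show "(a, x1, x2, x3) \<in> closed_hexablock" by (simp add: closed_hexablock_def)
qed

text \<open>
  The complement is the projection of a closed set along the compact closed bidisc.
\<close>

lemma open_hexablock: "open hexablock"
proof -
  define K where "K = (cball 0 1 \<times> cball 0 1 :: (complex \<times> complex) set)"
  define T :: "((complex \<times> complex) \<times> complex \<times> complex \<times> complex \<times> complex) set"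
    where "T = {q. cmod (tetra_poly (fst (snd (snd q))) (fst (snd (snd (snd q))))
        (snd (snd (snd (snd q)))) (fst (fst q)) (snd (fst q)))
      \<le> cmod (fst (snd q)) * defect (fst (fst q)) (snd (fst q))}"
  have "closed T"
    unfolding T_def by (intro closed_Collect_le continuous_intros)
  moreover have "compact K"
    unfolding K_def by (intro compact_Times compact_cball)
  ultimately have "closed {y. \<exists>x. x \<in> K \<and> (x, y) \<in> T}"
    by (intro closed_compact_projection)
  moreover have "- hexablock = {y. \<exists>x. x \<in> K \<and> (x, y) \<in> T}"
    by (force simp: mem_hexablock_iff K_def T_def not_less[symmetric])
  ultimately show ?thesis by (metis closed_def double_complement)
qed

section \<open>Closures\<close>

text \<open>
  For fixed first variable the polynomial is affine in the second one, and an affine function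
  \<open>B - C * y\<close> has no zero in the closed disc iff \<open>cmod C < cmod B\<close>. Unlike nonvanishing, an
  inequality between moduli can be carried over to limits.
\<close>

lemma tetrablock_iff_schur:
  "(x1, x2, x3) \<in> tetrablock \<longleftrightarrow> (\<forall>z\<in>cball 0 1. cmod (x2 - x3 * z) < cmod (1 - x1 * z))"
proof -
  have split: "1 - x1 * z - x2 * y + x3 * z * y = (1 - x1 * z) - (x2 - x3 * z) * y" for z y
    by (simp add: algebra_simps)
  have "(\<forall>y\<in>cball 0 1. B - C * y \<noteq> 0) \<longleftrightarrow> cmod C < cmod B" for B C :: complex
  proof
    assume ne: "\<forall>y\<in>cball 0 1. B - C * y \<noteq> 0"
    show "cmod C < cmod B"
    proof (rule ccontr)
      assume "\<not> cmod C < cmod B"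
      then have "B / C \<in> cball 0 1" "B - C * (B / C) = 0"
        by (auto simp: norm_divide divide_le_eq)
      then show False using ne by blast
    qed
  next
    assume lt: "cmod C < cmod B"
    show "\<forall>y\<in>cball 0 1. B - C * y \<noteq> 0"
    proof (intro ballI notI)
      fix y assume "y \<in> cball 0 1" "B - C * y = 0"
      then have "cmod B = cmod C * cmod y" "cmod y \<le> 1" by (simp_all add: norm_mult)
      then show False using lt mult_left_le[of "cmod y" "cmod C"] by simp
    qed
  qed
  then show ?thesis
    unfolding tetrablock_def by (simp add: split)
qed

lemma tetrablock_swap:
  assumes "(x1, x2, x3) \<in> tetrablock"
  shows "(x2, x1, x3) \<in> tetrablock"
proof -
  have "1 - x2 * z1 - x1 * z2 + x3 * z1 * z2 \<noteq> 0" if "z1 \<in> cball 0 1" "z2 \<in> cball 0 1" for z1 z2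
  proof -
    have "1 - x1 * z2 - x2 * z1 + x3 * z2 * z1 \<noteq> 0"
      using assms that unfolding tetrablock_def by blast
    then show ?thesis by (simp add: algebra_simps)
  qed
  then show ?thesis by (simp add: tetrablock_def)
qed

text \<open>
  The bound on \<open>x3\<close> averages the squares of \<open>tetrablock_iff_schur\<close> at $1$ and $-1$. The parallelogram
  law gives $|x_2|^2+|x_3|^2<1+|x_1|^2$, and adding the same inequality with $x_1,x_2$
  exchanged leaves $|x_3|^2<1$.
\<close>

lemma mem_tetrablock_cmod:
  assumes "(x1, x2, x3) \<in> tetrablock"
  shows "cmod x1 < 1" "cmod x2 < 1" "cmod x3 < 1"
proof -
  have first: "cmod y1 < 1" if "(y1, y2, y3) \<in> tetrablock" for y1 y2 y3
  proof (rule ccontr)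
    assume "\<not> cmod y1 < 1"
    then have "y1 \<noteq> 0" "1 / y1 \<in> cball 0 1" by (auto simp: norm_divide divide_le_eq)
    then show False
      using that[unfolded tetrablock_iff_schur, rule_format, of "1 / y1"] by simp
  qed
  show "cmod x1 < 1" "cmod x2 < 1"
    using first assms tetrablock_swap by blast+
  have avg: "(cmod y2)\<^sup>2 + (cmod y3)\<^sup>2 < 1 + (cmod y1)\<^sup>2" if "(y1, y2, y3) \<in> tetrablock" for y1 y2 y3
  proof -
    have "(cmod (y2 - y3))\<^sup>2 < (cmod (1 - y1))\<^sup>2" "(cmod (y2 + y3))\<^sup>2 < (cmod (1 + y1))\<^sup>2"
      using that[unfolded tetrablock_iff_schur, rule_format, of 1]
        that[unfolded tetrablock_iff_schur, rule_format, of "-1"]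
      by (auto intro!: power_strict_mono)
    then have "(cmod (y2 - y3))\<^sup>2 + (cmod (y2 + y3))\<^sup>2 < (cmod (1 - y1))\<^sup>2 + (cmod (1 + y1))\<^sup>2"
      by (rule add_strict_mono)
    moreover have "(cmod (u - v))\<^sup>2 + (cmod (u + v))\<^sup>2 = 2 * ((cmod u)\<^sup>2 + (cmod v)\<^sup>2)" for u v
      unfolding cmod_power2 by (simp add: power2_eq_square algebra_simps)
    ultimately show ?thesis by simp
  qed
  have "(cmod x3)\<^sup>2 < 1"
    using avg[OF assms] avg[OF tetrablock_swap[OF assms]] by linarith
  then show "cmod x3 < 1" by (simp add: abs_square_less_1)
qed

text \<open>
  In the limit \<open>tetrablock_iff_schur\<close> only gives \<open>cmod (x2 - x3 * z1) \<le> cmod (1 - x1 * z1)\<close>,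
  but strictness is recovered from the factor \<open>z2\<close>, whose modulus is less than 1. This works
  as long as the right-hand side is nonzero, which is guaranteed by the bound on \<open>x1\<close>.
\<close>

lemma closure_tetrablock_nonzero:
  assumes "(x1, x2, x3) \<in> closure tetrablock" and z: "z1 \<in> ball 0 1" "z2 \<in> ball 0 1"
  shows "tetra_poly x1 x2 x3 z1 z2 \<noteq> 0"
proof -
  define T where "T = {x. cmod (fst (snd x) - snd (snd x) * z1) \<le> cmod (1 - fst x * z1)} \<inter> {x. cmod (fst x) \<le> 1}"
  have "closed T"
    unfolding T_def by (intro closed_Int closed_Collect_le continuous_intros)
  moreover have "tetrablock \<subseteq> T"
  proof clarify
    fix y1 y2 y3 assume y: "(y1, y2, y3) \<in> tetrablock"
    then show "(y1, y2, y3) \<in> T"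
      using mem_tetrablock_cmod[OF y] y[unfolded tetrablock_iff_schur, rule_format, of z1] z
      by (simp add: T_def)
  qed
  ultimately have "(x1, x2, x3) \<in> T" using assms(1) closure_minimal by blast
  then have le: "cmod (x2 - x3 * z1) \<le> cmod (1 - x1 * z1)" and "cmod x1 \<le> 1"
    by (simp_all add: T_def)
  then have "cmod (x1 * z1) < 1"
    using z(1) mult_mono[of "cmod x1" 1 "cmod z1" "cmod z1"] by (simp add: norm_mult)
  then have pos: "0 < cmod (1 - x1 * z1)" by auto
  show ?thesis
  proof
    assume "tetra_poly x1 x2 x3 z1 z2 = 0"
    then have "1 - x1 * z1 = (x2 - x3 * z1) * z2" by (simp add: tetra_poly_def algebra_simps)
    then have "cmod (1 - x1 * z1) = cmod (x2 - x3 * z1) * cmod z2" by (simp add: norm_mult)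
    also have "\<dots> \<le> cmod (1 - x1 * z1) * cmod z2" using le by (rule mult_right_mono) simp
    also have "\<dots> < cmod (1 - x1 * z1)" using pos z(2) by simp
    finally show False by simp
  qed
qed

lemma closure_hexablock_snd:
  assumes "(a, x1, x2, x3) \<in> closure hexablock"
  shows "(x1, x2, x3) \<in> closure tetrablock"
proof -
  have "snd ` closure hexablock \<subseteq> closure tetrablock"
    by (rule image_closure_subset)
      (use closure_subset in \<open>fastforce simp: hexablock_def intro: continuous_intros\<close>)+
  then show ?thesis using assms by force
qed

lemma closure_hexablock: "closure hexablock = closed_hexablock"
proof
  show "closed_hexablock \<subseteq> closure hexablock"
    using mem_closure_of_dilates dilate_mem_hexablock by (meson less_imp_le subsetI)
  show "closure hexablock \<subseteq> closed_hexablock"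
  proof clarify
    fix a x1 x2 x3
    assume c: "(a, x1, x2, x3) \<in> closure hexablock"
    have "cmod a * defect z1 z2 \<le> cmod (tetra_poly x1 x2 x3 z1 z2)"
      if "z1 \<in> ball 0 1" "z2 \<in> ball 0 1" for z1 z2
    proof -
      define T where "T = {x. cmod (fst x) * defect z1 z2
        \<le> cmod (tetra_poly (fst (snd x)) (fst (snd (snd x))) (snd (snd (snd x))) z1 z2)}"
      have "closed T" unfolding T_def by (intro closed_Collect_le continuous_intros)
      moreover have "hexablock \<subseteq> T"
        using hexablock_subset_closed_hexablock that by (fastforce simp: closed_hexablock_def T_def)
      ultimately have "(a, x1, x2, x3) \<in> T" using c closure_minimal by blast
      then show ?thesis by (simp add: T_def)
    qed
    then show "(a, x1, x2, x3) \<in> closed_hexablock"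
      using closure_tetrablock_nonzero[OF closure_hexablock_snd[OF c]] by (simp add: closed_hexablock_def)
  qed
qed

lemma closure_hexablock_eq:
  "closure hexablock = {(a, x1, x2, x3). (x1, x2, x3) \<in> closure tetrablock \<and>
        (\<forall>z1\<in>ball 0 1. \<forall>z2\<in>ball 0 1. cmod (hexa_quot a x1 x2 x3 z1 z2) \<le> 1)}"
proof -
  have "(a, x1, x2, x3) \<in> closure hexablock \<longleftrightarrow> (x1, x2, x3) \<in> closure tetrablock \<and>
        (\<forall>z1\<in>ball 0 1. \<forall>z2\<in>ball 0 1. cmod (hexa_quot a x1 x2 x3 z1 z2) \<le> 1)" (is "?L \<longleftrightarrow> ?M \<and> ?R")
    for a x1 x2 x3
  proof (cases ?M)
    case False
    then show ?thesis using closure_hexablock_snd by blast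
  next
    case True
    have "cmod (hexa_quot a x1 x2 x3 z1 z2) \<le> 1 \<longleftrightarrow> tetra_poly x1 x2 x3 z1 z2 \<noteq> 0 \<and>
        cmod a * defect z1 z2 \<le> cmod (tetra_poly x1 x2 x3 z1 z2)"
      if "z1 \<in> ball 0 1" "z2 \<in> ball 0 1" for z1 z2
      using closure_tetrablock_nonzero[OF True that] cmod_hexa_quot[of z1 z2 a x1 x2 x3] that
      by (simp add: divide_le_eq)
    then show ?thesis
      using True by (simp add: closure_hexablock closed_hexablock_def)
  qed
  then show ?thesis by auto
qed

lemma closure_hexablock_subset_polydisc:
  "closure hexablock \<subseteq> cball 0 1 \<times> cball 0 1 \<times> cball 0 1 \<times> cball 0 1"
proof (rule closure_minimal)
  show "hexablock \<subseteq> cball 0 1 \<times> cball 0 1 \<times> cball 0 1 \<times> cball 0 1"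
  proof clarify
    fix a x1 x2 x3
    assume H: "(a, x1, x2, x3) \<in> hexablock"
    then have "cmod a \<le> 1"
      using H[unfolded mem_hexablock_iff, rule_format, of 0 0] by (simp add: defect_def tetra_poly_def)
    moreover have "(x1, x2, x3) \<in> tetrablock" using H by (simp add: hexablock_def)
    ultimately show "a \<in> cball 0 1 \<and> (x1, x2, x3) \<in> cball 0 1 \<times> cball 0 1 \<times> cball 0 1"
      using mem_tetrablock_cmod by fastforce
  qed
qed (intro closed_Times closed_cball)

section \<open>The structured singular value\<close>

lemma op_norm_nonneg: "0 \<le> op_norm A"
  by (rule onorm_pos_le) simp

lemma det_pencil_nonzero_of_small:
  assumes "op_norm A * op_norm X < 1"
  shows "det (mat 1 - A ** X) \<noteq> 0"
proof
  assume "det (mat 1 - A ** X) = 0"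
  then obtain v where v: "v \<noteq> 0" "(mat 1 - A ** X) *v v = 0"
    using invertible_det_nz[of "mat 1 - A ** X"] invertible_left_inverse[of "mat 1 - A ** X"]
      matrix_left_invertible_ker[of "mat 1 - A ** X"] by blast
  then have "v = A *v (X *v v)"
    by (simp add: matrix_vector_mult_diff_rdistrib matrix_vector_mul_assoc)
  then have "norm v \<le> op_norm A * norm (X *v v)"
    using onorm[OF matrix_vector_mul_bounded_linear[of A], of "X *v v"] by simp
  also have "\<dots> \<le> op_norm A * (op_norm X * norm v)"
    using onorm[OF matrix_vector_mul_bounded_linear[of X], of v] op_norm_nonneg by (rule mult_left_mono)
  also have "\<dots> < norm v"
    using assms v(1) by (simp flip: mult.assoc)
  finally show False by simp
qed

text \<open>
  A zero of the determinant in the unit ball makes the infimum at most 1. The infimum is also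
  positive, since \<open>det_pencil_nonzero_of_small\<close> keeps the zeros away from the origin; otherwise the
  convention \<open>1 / 0 = 0\<close> would make \<open>mu_hexa\<close> small.
\<close>

lemma hexa_proj_mem_hexablock_of_mu:
  assumes "mu_hexa A < 1"
  shows "hexa_proj A \<in> hexablock"
  unfolding hexa_proj_mem_hexablock_iff
proof (intro ballI impI notI)
  fix X
  assume X: "X \<in> upper_triangular_mats" "op_norm X \<le> 1" "det (mat 1 - A ** X) = 0"
  define N where "N = {op_norm X | X. X \<in> upper_triangular_mats \<and> det (mat 1 - A ** X) = 0}"
  have XN: "op_norm X \<in> N" using X by (auto simp: N_def)
  have mu: "mu_hexa A = 1 / Inf N"
    using X unfolding mu_hexa_def N_def by auto
  have ge: "1 \<le> op_norm A * n" if "n \<in> N" for n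
    using that det_pencil_nonzero_of_small by (force simp: N_def not_less[symmetric])
  have A: "0 < op_norm A"
    using ge[OF XN] op_norm_nonneg[of A] by (cases "op_norm A = 0") auto
  have "1 / op_norm A \<le> Inf N"
    using XN ge A by (intro cInf_greatest) (auto simp: divide_le_eq mult.commute)
  then have pos: "0 < Inf N"
    using A by (meson divide_pos_pos less_le_trans zero_less_one)
  have "Inf N \<le> op_norm X"
    using XN op_norm_nonneg by (intro cInf_lower bdd_belowI[of _ 0]) (auto simp: N_def)
  then show False
    using X(2) pos assms mu by (simp add: divide_less_eq)
qed

text \<open>
  The factor \<open>r\<close> pushes all zeros out to norm at least \<open>1 / r\<close>. The infimum thus
  exceeds 1 without any need to know whether it is attained.
\<close>

lemma mu_hexa_scaleR_less_1:
  assumes "hexa_proj A \<in> hexablock" and r: "0 < r" "r < 1"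
  shows "mu_hexa (r *\<^sub>R A) < 1"
proof (cases "\<forall>X\<in>upper_triangular_mats. det (mat 1 - (r *\<^sub>R A) ** X) \<noteq> 0")
  case True
  then show ?thesis by (simp add: mu_hexa_def)
next
  case False
  define N where "N = {op_norm X | X. X \<in> upper_triangular_mats \<and> det (mat 1 - (r *\<^sub>R A) ** X) = 0}"
  have mu: "mu_hexa (r *\<^sub>R A) = 1 / Inf N"
    using False unfolding mu_hexa_def N_def by auto
  have "1 / r \<le> Inf N"
  proof (rule cInf_greatest)
    show "N \<noteq> {}" using False by (auto simp: N_def)
    fix n assume "n \<in> N"
    then obtain X where X: "X \<in> upper_triangular_mats" "det (mat 1 - (r *\<^sub>R A) ** X) = 0"
      and n: "n = op_norm X" by (auto simp: N_def)
    have "(r *\<^sub>R A) ** X = A ** (r *\<^sub>R X)"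
      by (simp add: vec_eq_iff matrix_matrix_mult_def)
    moreover have "r *\<^sub>R X \<in> upper_triangular_mats"
      using X(1) by (simp add: upper_triangular_mats_def)
    ultimately have "1 < op_norm (r *\<^sub>R X)"
      using assms(1) X(2) unfolding hexa_proj_mem_hexablock_iff by force
    moreover have "(\<lambda>v. (r *\<^sub>R X) *v v) = (\<lambda>v. r *\<^sub>R (X *v v))"
      by (simp add: fun_eq_iff vec_eq_iff matrix_vector_mult_def sum_2 scaleR_right_distrib)
    ultimately have "1 < r * op_norm X"
      using r onorm_scaleR[OF matrix_vector_mul_bounded_linear[of X], of r] by simp
    then show "1 / r \<le> n" using r n by (simp add: divide_le_eq mult.commute)
  qed
  then have "1 < Inf N" using r by (smt (verit) less_divide_eq_1_pos)
  then show ?thesis by (simp add: mu)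
qed

lemma hexa_proj_scaleR: "hexa_proj (r *\<^sub>R A) = dilate r (hexa_proj A)"
  by (simp add: hexa_proj_def dilate_def det_2 power2_eq_square scaleR_right_diff_distrib)

lemma hexa_proj_onto:
  assumes "a \<noteq> 0"
  obtains A where "hexa_proj A = (a, x1, x2, x3)"
proof
  show "hexa_proj (vector [vector [x1, (x1 * x2 - x3) / a], vector [a, x2]]) = (a, x1, x2, x3)"
    using assms by (simp add: hexa_proj_def det_2)
qed

text \<open>
  A point \<open>(0, x1, x2, x3)\<close> equals \<open>hexa_proj A\<close> for some \<open>A\<close> only if \<open>x3 = x1 * x2\<close>, so the points with
  vanishing first coordinate have to be approximated by others; openness of the hexablock makes
  this possible.
\<close>

lemma closure_H_mu: "closure H_mu = closure hexablock"
proof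
  show "closure H_mu \<subseteq> closure hexablock"
    using hexa_proj_mem_hexablock_of_mu by (intro closure_mono) (auto simp: H_mu_def)
  define D where "D = ((- {0}) \<times> UNIV :: (complex \<times> complex \<times> complex \<times> complex) set)"
  have "hexablock \<inter> D \<subseteq> closure H_mu"
  proof
    fix p assume p: "p \<in> hexablock \<inter> D"
    then obtain A where A: "hexa_proj A = p"
      using hexa_proj_onto by (metis (no_types, lifting) D_def Compl_iff IntD2 SigmaE insertI1 prod_cases3)
    show "p \<in> closure H_mu"
    proof (rule mem_closure_of_dilates)
      fix r :: real assume "0 < r" "r < 1"
      then have "mu_hexa (r *\<^sub>R A) < 1" using p A by (intro mu_hexa_scaleR_less_1) auto
      then show "dilate r p \<in> H_mu"
        unfolding A[symmetric] hexa_proj_scaleR[symmetric] H_mu_def by blast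
    qed
  qed
  moreover have "closure D = UNIV"
    by (simp add: D_def closure_Times closure_complement)
  then have "hexablock \<subseteq> closure (hexablock \<inter> D)"
    using open_Int_closure_subset[OF open_hexablock, of D] by simp
  ultimately have "hexablock \<subseteq> closure H_mu"
    by (meson closed_closure closure_minimal order_trans)
  then show "closure hexablock \<subseteq> closure H_mu" by (simp add: closure_minimal)
qed

lemma H_N_subset_hexablock: "H_N \<subseteq> hexablock"
proof -
  have "hexa_proj A \<in> hexablock" if "op_norm A < 1" for A
    unfolding hexa_proj_mem_hexablock_iff
  proof (intro ballI impI det_pencil_nonzero_of_small)
    fix X assume "op_norm X \<le> 1"
    then show "op_norm A * op_norm X < 1"
      using that op_norm_nonneg[of A] mult_left_le[of "op_norm X" "op_norm A"] by linarith
  qed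
  then show ?thesis by (auto simp: H_N_def)
qed

theorem theorem5p3:
  shows "interior (closure H_mu) = hexablock
    \<and> closure H_mu = closure hexablock
    \<and> closure hexablock = {(a, x1, x2, x3). (x1, x2, x3) \<in> closure tetrablock \<and>
        (\<forall>z1\<in>ball 0 1. \<forall>z2\<in>ball 0 1. cmod (hexa_quot a x1 x2 x3 z1 z2) \<le> 1)}
    \<and> closure H_N \<subseteq> closure hexablock
    \<and> closure hexablock \<subseteq> cball 0 1 \<times> cball 0 1 \<times> cball 0 1 \<times> cball 0 1"
proof (intro conjI)
  show "interior (closure H_mu) = hexablock"
    unfolding closure_H_mu
  proof
    show "interior (closure hexablock) \<subseteq> hexablock"
      unfolding closure_hexablock by (rule interior_closed_hexablock_subset)
    show "hexablock \<subseteq> interior (closure hexablock)"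
      using open_hexablock closure_subset by (rule interior_maximal[rotated])
  qed
  show "closure H_N \<subseteq> closure hexablock"
    using H_N_subset_hexablock by (rule closure_mono)
qed (rule closure_H_mu closure_hexablock_eq closure_hexablock_subset_polydisc)+

end
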